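(* Let $I=[0,\infty]$, let $\mu$ be a Borel probability measure on $I$, and let $\tau_1,\tau_2,\dots$ be i.i.d. with law $\mu$ under $\mathbb{P}$. Fix $T>0$, $\mathsf{R}\ge0$, $0\le\alpha<\beta\le1$, put $F(T-)=\mu[0,T)$, and assume $\alpha>F(T-)>0$ and $\mu[0,T')<\mu[0,T]$ for all $T'\in[0,T)$. Define $L^{(N)}_t=\frac1N\sum_{n=1}^N\chi_{\{\tau_n\le t\}}$, $\bar L^{(N)}_t=\frac{(L^{(N)}_t-\alpha)^+-(L^{(N)}_t-\beta)^+}{\beta-\alpha}$, $\mathbf{P}^{\mathrm{prot}}_N=\int_{[0,T)}e^{-\mathsf{R}s}d\bar L^{(N)}_s$, $\varkappa=\ln\big(\frac{\alpha}{1-\alpha}\frac{1-F(T-)}{F(T-)}\big)$, $\mathfrak{I}(\alpha)=\inf\{H(\mu'|\mu):\mu'\in\mathscr{P}(I),\ \mu'[0,T)\ge\alpha\}$, and $$\tilde\mu^*_\alpha(A)=\mu(A\cap[0,T))\frac{\alpha}{F(T-)}+\mu(A\cap[T,\infty])\frac{1-\alpha}{1-F(T-)}.$$ For each $N\ge1$ define the probability measure $\tilde{\mathbb{P}}_N(A)=\mathbb{E}\big[\chi_A\prod_{n=1}^N\frac{d\tilde\mu^*_\alpha}{d\mu}(\tau_n)\big]$ (with expectation $\tilde{\mathbb{E}}_N$) and $\gamma_N=\sum_{n=1}^N\{\chi_{[0,T)}(\tau_n)-\alpha\}=N(L^{(N)}_{T-}-\alpha)$. Then for every positive integer $N$, $$\mathbb{E}[\mathbf{P}^{\mathrm{prot}}_N]=I_Ne^{-N\mathfrak{I}(\alpha)},\qquad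 I_N=\tilde{\mathbb{E}}_N\big[\mathbf{P}^{\mathrm{prot}}_N\exp[-\varkappa\gamma_N]\chi_{\{\gamma_N>0\}}\big],$$ and under $\tilde{\mathbb{P}}_N$ the random variables $\tau_1,\dots,\tau_N$ are i.i.d. with common law $\tilde\mu^*_\alpha$.
   Context: $\mathscr{P}(I)$ is the set of Borel probability measures on $I=[0,\infty]$ (compactified half-line). $H(\mu'|\mu)=\int\ln\frac{d\mu'}{d\mu}\,d\mu'$ if $\mu'\ll\mu$, $\infty$ otherwise. $L^{(N)}_{T-}$ is the left limit at $T$, i.e. $\frac1N\sum_n\chi_{[0,T)}(\tau_n)$. *)

theory Defs
  imports "HOL-Probability.Probability"
begin

text \<open>The compactified half-line I = [0,\<infinity>] is modelled by the type ennreal with its Borel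
  sigma-algebra. Time parameters t are real; the event tau \<le> t is tau \<le> ennreal t for t \<ge> 0.\<close>

text \<open>Empirical distribution function L^(N)_t(omega) = (1/N) sum_{n=1}^N chi{tau_n \<le> t}.
  For t < 0 it is 0 (no default before time 0); this is needed so that the Stieltjes measure
  below charges the jump at time 0.\<close>
definition Lemp :: "nat \<Rightarrow> (nat \<Rightarrow> 'a \<Rightarrow> ennreal) \<Rightarrow> real \<Rightarrow> 'a \<Rightarrow> real" where
  "Lemp N \<tau> t \<omega> = (if t < 0 then 0
      else (\<Sum>n\<in>{1..N}. indicator {..ennreal t} (\<tau> n \<omega>)) / real N)"

definition Lbar :: "nat \<Rightarrow> (nat \<Rightarrow> 'a \<Rightarrow> ennreal) \<Rightarrow> real \<Rightarrow> real \<Rightarrow> real \<Rightarrow> 'a \<Rightarrow> real" where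
  "Lbar N \<tau> \<alpha> \<beta> t \<omega> =
     (max (Lemp N \<tau> t \<omega> - \<alpha>) 0 - max (Lemp N \<tau> t \<omega> - \<beta>) 0) / (\<beta> - \<alpha>)"

definition Pprot :: "nat \<Rightarrow> (nat \<Rightarrow> 'a \<Rightarrow> ennreal) \<Rightarrow> real \<Rightarrow> real \<Rightarrow> real \<Rightarrow> real \<Rightarrow> 'a \<Rightarrow> real" where
  "Pprot N \<tau> \<alpha> \<beta> R T \<omega> =
     (\<integral>s. indicator {0..<T} s * exp (- R * s) \<partial>(interval_measure (\<lambda>t. Lbar N \<tau> \<alpha> \<beta> t \<omega>)))"

definition relent :: "'b measure \<Rightarrow> 'b measure \<Rightarrow> ereal" where
  "relent \<mu>' \<mu> =
     (if absolutely_continuous \<mu> \<mu>' then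
        (let g = (\<lambda>x. ln (enn2real (RN_deriv \<mu> \<mu>' x))) in
           enn2ereal (\<integral>\<^sup>+x. ennreal (g x) \<partial>\<mu>') - enn2ereal (\<integral>\<^sup>+x. ennreal (- g x) \<partial>\<mu>'))
      else \<infinity>)"

definition Ifrak :: "ennreal measure \<Rightarrow> real \<Rightarrow> real \<Rightarrow> ereal" where
  "Ifrak \<mu> T \<alpha> = Inf {relent \<mu>' \<mu> | \<mu>'. prob_space \<mu>' \<and> sets \<mu>' = sets (borel :: ennreal measure)
                                     \<and> measure \<mu>' {..<ennreal T} \<ge> \<alpha>}"

definition mutilde :: "ennreal measure \<Rightarrow> real \<Rightarrow> real \<Rightarrow> ennreal measure" where
  "mutilde \<mu> T \<alpha> = density \<mu> (\<lambda>x. ennreal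
      (if x < ennreal T then \<alpha> / measure \<mu> {..<ennreal T}
       else (1 - \<alpha>) / (1 - measure \<mu> {..<ennreal T})))"

definition Ptilde :: "'a measure \<Rightarrow> ennreal measure \<Rightarrow> (nat \<Rightarrow> 'a \<Rightarrow> ennreal) \<Rightarrow> real \<Rightarrow> real \<Rightarrow> nat \<Rightarrow> 'a measure" where
  "Ptilde P \<mu> \<tau> T \<alpha> N = density P (\<lambda>\<omega>. \<Prod>n\<in>{1..N}. RN_deriv \<mu> (mutilde \<mu> T \<alpha>) (\<tau> n \<omega>))"

definition kappa :: "ennreal measure \<Rightarrow> real \<Rightarrow> real \<Rightarrow> real" where
  "kappa \<mu> T \<alpha> = ln (\<alpha> / (1 - \<alpha>) * ((1 - measure \<mu> {..<ennreal T}) / measure \<mu> {..<ennreal T}))"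

definition gammaN :: "nat \<Rightarrow> (nat \<Rightarrow> 'a \<Rightarrow> ennreal) \<Rightarrow> real \<Rightarrow> real \<Rightarrow> 'a \<Rightarrow> real" where
  "gammaN N \<tau> T \<alpha> \<omega> = (\<Sum>n\<in>{1..N}. indicator {..<ennreal T} (\<tau> n \<omega>) - \<alpha>)"

end

theory Submission
  imports Defs
begin

text \<open>Since \<open>d\<mu>\<^sup>*/d\<mu>\<close> is constant on \<open>[0,T)\<close> and on \<open>[T,\<infinity>]\<close>, the likelihood ratio
  \<open>\<Prod>\<^sub>n (d\<mu>\<^sup>*/d\<mu>)(\<tau>\<^sub>n)\<close> depends only on the number of defaults before \<open>T\<close>, and it equals
  \<open>exp (N J + \<kappa> \<gamma>\<^sub>N)\<close> with \<open>J = H(\<mu>\<^sup>* | \<mu>)\<close>. Gibbs' inequality against \<open>ln (d\<mu>\<^sup>*/d\<mu>)\<close>, which is larger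
  on \<open>[0,T)\<close>, shows that \<open>\<mu>\<^sup>*\<close> attains the infimum, so \<open>J\<close> is the rate. Changing measure gives the
  representation, because the payoff vanishes unless \<open>\<gamma>\<^sub>N > 0\<close>: otherwise the loss stays below the
  attachment point \<open>\<alpha>\<close> on \<open>[0,T)\<close>.\<close>

section \<open>Change of measure by product densities\<close>

text \<open>A product measure is determined by its values on boxes, where density and indicator both
  factor over the coordinates and Tonelli applies. The assumptions range over all \<open>i\<close>,
  as \<open>product_sigma_finite\<close> demands.\<close>

lemma density_PiM:
  assumes I: "finite I"
    and M: "\<And>i. prob_space (M i)"
    and \<phi>: "\<And>i. \<phi> i \<in> borel_measurable (M i)"
    and D: "\<And>i. prob_space (density (M i) (\<phi> i))"
  shows "density (PiM I M) (\<lambda>x. \<Prod>i\<in>I. \<phi> i (x i)) = PiM I (\<lambda>i. density (M i) (\<phi> i))"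
proof -
  interpret M: product_sigma_finite M
    by (simp add: product_sigma_finite_def M prob_space_imp_sigma_finite)
  interpret D: product_sigma_finite "\<lambda>i. density (M i) (\<phi> i)"
    by (simp add: product_sigma_finite_def D prob_space_imp_sigma_finite)
  note \<phi>[measurable]
  show ?thesis
  proof (rule D.PiM_eqI[OF I])
    show "sets (density (PiM I M) (\<lambda>x. \<Prod>i\<in>I. \<phi> i (x i))) = sets (PiM I (\<lambda>i. density (M i) (\<phi> i)))"
      by (simp cong: sets_PiM_cong)
  next
    fix A assume "\<And>i. i \<in> I \<Longrightarrow> A i \<in> sets (density (M i) (\<phi> i))"
    then have A: "\<And>i. i \<in> I \<Longrightarrow> A i \<in> sets (M i)" by simp
    \<comment> \<open>Points of the product space are extensional, so one outside the box fails at
      some \<open>j\<close> in \<open>I\<close>, and that factor makes the product 0.\<close>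
    have ind: "indicator (Pi\<^sub>E I A) x = (\<Prod>i\<in>I. indicator (A i) (x i) :: ennreal)"
      if "x \<in> space (PiM I M)" for x
    proof (cases "x \<in> Pi\<^sub>E I A")
      case False
      with that obtain j where "j \<in> I" "x j \<notin> A j"
        by (auto simp: space_PiM PiE_iff)
      with False I show ?thesis
        by (simp add: prod_zero_iff) (metis indicator_simps(2))
    qed (auto simp: PiE_iff)
    have "emeasure (density (PiM I M) (\<lambda>x. \<Prod>i\<in>I. \<phi> i (x i))) (Pi\<^sub>E I A)
        = (\<integral>\<^sup>+x. (\<Prod>i\<in>I. \<phi> i (x i)) * indicator (Pi\<^sub>E I A) x \<partial>PiM I M)"
      using A I by (intro emeasure_density) (auto intro!: sets_PiM_I_finite)
    also have "\<dots> = (\<integral>\<^sup>+x. (\<Prod>i\<in>I. \<phi> i (x i) * indicator (A i) (x i)) \<partial>PiM I M)"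
      by (intro nn_integral_cong) (simp add: ind prod.distrib)
    also have "\<dots> = (\<Prod>i\<in>I. \<integral>\<^sup>+y. \<phi> i y * indicator (A i) y \<partial>M i)"
      using A by (intro M.product_nn_integral_prod[OF I] borel_measurable_times_ennreal borel_measurable_indicator \<phi>)
    also have "\<dots> = (\<Prod>i\<in>I. emeasure (density (M i) (\<phi> i)) (A i))"
      using A by (intro prod.cong) (auto simp: emeasure_density)
    finally show "emeasure (density (PiM I M) (\<lambda>x. \<Prod>i\<in>I. \<phi> i (x i))) (Pi\<^sub>E I A)
        = (\<Prod>i\<in>I. emeasure (density (M i) (\<phi> i)) (A i))" .
  qed
qed

text \<open>Independence says that the joint law is the product of the marginals. The weight is a
  function of the tuple, so it can be moved onto the joint law, where it yields another product
  measure. All three conclusions are read off from that joint law.\<close>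

lemma indep_vars_product_density:
  fixes X :: "'i \<Rightarrow> 'a \<Rightarrow> 'b"
  assumes P: "prob_space P"
    and I: "finite I" "I \<noteq> {}"
    and indep: "prob_space.indep_vars P (\<lambda>_. S) X I"
    and law: "\<And>i. i \<in> I \<Longrightarrow> distr P S (X i) = \<mu>"
    and \<phi>: "\<phi> \<in> borel_measurable \<mu>"
    and D: "prob_space (density \<mu> \<phi>)"
  defines "Q \<equiv> density P (\<lambda>\<omega>. \<Prod>i\<in>I. \<phi> (X i \<omega>))"
  shows "prob_space Q"
    and "prob_space.indep_vars Q (\<lambda>_. S) X I"
    and "\<And>i. i \<in> I \<Longrightarrow> distr Q S (X i) = density \<mu> \<phi>"
proof -
  interpret P: prob_space P by fact
  have X[measurable]: "\<And>i. i \<in> I \<Longrightarrow> X i \<in> measurable P S"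
    using indep by (simp add: P.indep_vars_def)
  obtain j where j: "j \<in> I" using I by auto
  have \<mu>: "prob_space \<mu>" and sets_\<mu>: "sets \<mu> = sets S"
    using P.prob_space_distr[OF X[OF j]] law[OF j] sets_distr[of P S "X j"] by auto
  have \<phi>_S[measurable]: "\<phi> \<in> borel_measurable S"
    using \<phi> by (simp cong: measurable_cong_sets add: sets_\<mu>)
  let ?X = "\<lambda>\<omega>. \<lambda>i\<in>I. X i \<omega>"
  let ?S = "PiM I (\<lambda>_. S)"
  have "distr P ?S ?X = PiM I (\<lambda>i. distr P S (X i))"
    using P.indep_vars_iff_distr_eq_PiM'[OF I(2), where X=X and M'="\<lambda>_. S"] X indep by simp
  also have "\<dots> = PiM I (\<lambda>_. \<mu>)"
    by (intro PiM_cong) (auto simp: law)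
  finally have distr_X: "distr P ?S ?X = PiM I (\<lambda>_. \<mu>)" .
  \<comment> \<open>Writing the weight as a function of the restricted tuple \<open>?X\<close>
    prepares for \<open>density_distr\<close>.\<close>
  have Q_eq: "Q = density P (\<lambda>\<omega>. (\<Prod>i\<in>I. \<phi> (?X \<omega> i)))"
    unfolding Q_def by (intro arg_cong2[where f=density] refl ext prod.cong) auto
  have joint: "distr Q ?S ?X = PiM I (\<lambda>_. density \<mu> \<phi>)"
    unfolding Q_eq
    by (subst density_distr[symmetric])
       (auto simp: distr_X density_PiM[OF I(1), of "\<lambda>_. \<mu>" "\<lambda>_. \<phi>"] \<mu> D \<phi>)
  have XQ[measurable]: "\<And>i. i \<in> I \<Longrightarrow> X i \<in> measurable Q S"
    by (simp add: Q_def X)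
  have XQ': "?X \<in> measurable Q ?S" by measurable
  show Q: "prob_space Q"
  proof
    interpret J: prob_space "PiM I (\<lambda>_. density \<mu> \<phi>)" by (intro prob_space_PiM D)
    have "emeasure Q (space Q) = emeasure (distr Q ?S ?X) (space ?S)"
      using XQ' measurable_space[OF XQ']
      by (subst emeasure_distr) (auto intro!: arg_cong2[where f=emeasure])
    also have "\<dots> = 1"
      using J.emeasure_space_1 joint by (metis space_distr)
    finally show "emeasure Q (space Q) = 1" .
  qed
  show marg: "distr Q S (X i) = density \<mu> \<phi>" if i: "i \<in> I" for i
  proof -
    have "distr Q S (X i) = distr (distr Q ?S ?X) S (\<lambda>x. x i)"
      using i XQ' by (subst distr_distr) (auto simp: comp_def)
    \<comment> \<open>The target is changed to a measure with the same sets, the form that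
      \<open>distr_PiM_component\<close> expects.\<close>
    also have "\<dots> = distr (PiM I (\<lambda>_. density \<mu> \<phi>)) (density \<mu> \<phi>) (\<lambda>x. x i)"
      unfolding joint by (intro distr_cong) (auto simp: sets_\<mu>)
    also have "\<dots> = density \<mu> \<phi>"
      using distr_PiM_component[of I "\<lambda>_. density \<mu> \<phi>" i] D i by simp
    finally show ?thesis .
  qed
  show "prob_space.indep_vars Q (\<lambda>_. S) X I"
    using prob_space.indep_vars_iff_distr_eq_PiM'[OF Q I(2), where X=X and M'="\<lambda>_. S"] XQ
    by (simp add: joint marg cong: PiM_cong)
qed

section \<open>Relative entropy and Gibbs' inequality\<close>

lemma relent_eq_integral:
  assumes "absolutely_continuous \<mu> \<mu>'"
    and int: "integrable \<mu>' (\<lambda>x. ln (enn2real (RN_deriv \<mu> \<mu>' x)))"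
  shows "relent \<mu>' \<mu> = ereal (\<integral>x. ln (enn2real (RN_deriv \<mu> \<mu>' x)) \<partial>\<mu>')"
proof -
  let ?g = "\<lambda>x. ln (enn2real (RN_deriv \<mu> \<mu>' x))"
  have "(\<integral>\<^sup>+x. ennreal (?g x) \<partial>\<mu>') < \<infinity>" "(\<integral>\<^sup>+x. ennreal (- ?g x) \<partial>\<mu>') < \<infinity>"
    using int by (auto simp: real_integrable_def top.not_eq_extremum)
  then obtain a b where "(\<integral>\<^sup>+x. ennreal (?g x) \<partial>\<mu>') = ennreal a" "0 \<le> a"
      "(\<integral>\<^sup>+x. ennreal (- ?g x) \<partial>\<mu>') = ennreal b" "0 \<le> b"
    by (auto simp: less_top_ennreal)
  then show ?thesis
    using assms(1) by (simp add: relent_def real_lebesgue_integral_def[OF int] enn2ereal_ennreal)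
qed

text \<open>With \<open>h\<close> the density, \<open>h * (\<phi> / h)\<close> is
  \<open>\<phi>\<close> where \<open>h\<close> is positive and finite, but 0 where
  \<open>h = 0\<close>. The mass of \<open>\<phi>\<close> on that set is lost, hence only an
  inequality.\<close>

lemma nn_integral_divide_RN_deriv_le:
  assumes \<mu>: "prob_space \<mu>" and \<mu>': "prob_space \<mu>'" "sets \<mu>' = sets \<mu>"
    and ac: "absolutely_continuous \<mu> \<mu>'"
    and [measurable]: "\<phi> \<in> borel_measurable \<mu>" and nn: "\<And>x. 0 \<le> \<phi> x"
  shows "(\<integral>\<^sup>+x. ennreal (\<phi> x / enn2real (RN_deriv \<mu> \<mu>' x)) \<partial>\<mu>') \<le> (\<integral>\<^sup>+x. ennreal (\<phi> x) \<partial>\<mu>)"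
proof -
  interpret \<mu>: prob_space \<mu> by fact
  interpret \<mu>': prob_space \<mu>' by fact
  let ?h = "RN_deriv \<mu> \<mu>'"
  have "(\<integral>\<^sup>+x. ennreal (\<phi> x / enn2real (?h x)) \<partial>\<mu>')
      = (\<integral>\<^sup>+x. ?h x * ennreal (\<phi> x / enn2real (?h x)) \<partial>\<mu>)"
    by (rule \<mu>.RN_deriv_nn_integral[OF ac \<mu>'(2)]) measurable
  also have "\<dots> \<le> (\<integral>\<^sup>+x. ennreal (\<phi> x) \<partial>\<mu>)"
  proof (rule nn_integral_mono_AE)
    have "AE x in \<mu>. ?h x \<noteq> \<infinity>"
      by (rule \<mu>.RN_deriv_finite[OF _ ac \<mu>'(2)]) unfold_locales
    then show "AE x in \<mu>. ?h x * ennreal (\<phi> x / enn2real (?h x)) \<le> ennreal (\<phi> x)"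
    proof eventually_elim
      case (elim x)
      then obtain r where r: "?h x = ennreal r" "0 \<le> r"
        by (cases "?h x") auto
      then show ?case
        using nn[of x] by (simp flip: ennreal_mult)
    qed
  qed
  finally show ?thesis .
qed

text \<open>\<open>\<integral> ln (\<phi> / h) d\<mu>' \<le> \<integral> \<phi> d\<mu> - 1 \<le> 0\<close> for \<open>h = d\<mu>'/d\<mu>\<close>.\<close>

lemma relent_ge_integral_ln:
  assumes \<mu>: "prob_space \<mu>" and \<mu>': "prob_space \<mu>'" "sets \<mu>' = sets \<mu>"
    and [measurable]: "\<phi> \<in> borel_measurable \<mu>" and pos: "\<And>x. 0 < \<phi> x"
    and le1: "(\<integral>\<^sup>+x. ennreal (\<phi> x) \<partial>\<mu>) \<le> 1"
    and int: "integrable \<mu>' (\<lambda>x. ln (\<phi> x))"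
  shows "ereal (\<integral>x. ln (\<phi> x) \<partial>\<mu>') \<le> relent \<mu>' \<mu>"
proof (cases "absolutely_continuous \<mu> \<mu>'")
  case False
  then show ?thesis by (simp add: relent_def)
next
  case ac: True
  interpret \<mu>: prob_space \<mu> by fact
  interpret \<mu>': prob_space \<mu>' by fact
  note \<mu>'(2)[measurable_cong]
  let ?h = "RN_deriv \<mu> \<mu>'"
  let ?g = "\<lambda>x. ln (enn2real (?h x))"
  \<comment> \<open>The negative part of the log density has integral at most 1, so the difference
    in \<open>relent\<close> is never infinity minus infinity. Where the real density is 0, both
    sides of the pointwise bound are 0, since \<open>ln 0 = 0\<close> and
    \<open>1 / 0 = 0\<close>.\<close>
  have "(\<integral>\<^sup>+x. ennreal (- ?g x) \<partial>\<mu>') \<le> (\<integral>\<^sup>+x. ennreal (1 / enn2real (?h x)) \<partial>\<mu>')"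
  proof (intro nn_integral_mono ennreal_leI)
    fix x
    show "- ?g x \<le> 1 / enn2real (?h x)"
    proof (cases "enn2real (?h x) = 0")
      case False
      then have "0 < enn2real (?h x)"
        using enn2real_nonneg[of "?h x"] by linarith
      then show ?thesis
        using ln_le_minus_one[of "1 / enn2real (?h x)"] by (simp add: ln_div)
    qed simp
  qed
  also have "\<dots> \<le> (\<integral>\<^sup>+x. ennreal 1 \<partial>\<mu>)"
    by (rule nn_integral_divide_RN_deriv_le[OF \<mu> \<mu>' ac]) auto
  finally have neg: "(\<integral>\<^sup>+x. ennreal (- ?g x) \<partial>\<mu>') \<le> 1"
    by (simp add: \<mu>.emeasure_space_1)
  show ?thesis
  proof (cases "(\<integral>\<^sup>+x. ennreal (?g x) \<partial>\<mu>') = \<infinity>")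
    case True
    moreover have "enn2ereal (\<integral>\<^sup>+x. ennreal (- ?g x) \<partial>\<mu>') \<noteq> \<infinity>"
      using neg by (metis ennreal_one_neq_top enn2ereal_eq_top_iff infinity_ennreal_def neq_top_trans)
    ultimately have "relent \<mu>' \<mu> = \<infinity>"
      using ac by (simp add: relent_def)
    then show ?thesis by simp
  next
    case False
    have int_g: "integrable \<mu>' ?g"
      using False neg by (auto simp: real_integrable_def top_unique)
    let ?q = "\<lambda>x. \<phi> x / enn2real (?h x)"
    have q: "(\<integral>\<^sup>+x. ennreal (?q x) \<partial>\<mu>') \<le> 1"
      using nn_integral_divide_RN_deriv_le[OF \<mu> \<mu>' ac, of \<phi>] le1 pos
      by (auto intro: order_trans less_imp_le)
    have q_nn: "0 \<le> ?q x" for x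
      using pos[of x] by simp
    have int_q: "integrable \<mu>' ?q"
      using q q_nn by (intro integrableI_nonneg) (auto intro: le_less_trans)
    have q1: "(\<integral>x. ?q x \<partial>\<mu>') \<le> 1"
      using q q_nn by (subst (asm) nn_integral_eq_integral[OF int_q]) (auto simp: ennreal_le_1)
    have fin: "AE x in \<mu>. ?h x \<noteq> \<infinity>"
      by (rule \<mu>.RN_deriv_finite[OF _ ac \<mu>'(2)]) unfold_locales
    \<comment> \<open>The zero set of \<open>?h\<close> carries no mass of \<mu>', so the logarithm
      of the quotient splits almost everywhere.\<close>
    then have "AE x in density \<mu> ?h. 0 < ?h x \<and> ?h x \<noteq> \<infinity>"
      by (auto simp: AE_density elim: eventually_mono)
    then have "AE x in \<mu>'. 0 < ?h x \<and> ?h x \<noteq> \<infinity>"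
      unfolding \<mu>.density_RN_deriv[OF ac \<mu>'(2)] .
    \<comment> \<open>This is \<open>ln u \<le> u - 1\<close> at \<open>u = ?q x\<close>.\<close>
    then have "AE x in \<mu>'. ln (\<phi> x) - ?g x \<le> ?q x - 1"
    proof eventually_elim
      case (elim x)
      then have "0 < enn2real (?h x)"
        by (simp add: enn2real_positive_iff top.not_eq_extremum)
      then show ?case
        using pos[of x] ln_le_minus_one[of "?q x"] by (simp add: ln_div)
    qed
    then have "(\<integral>x. ln (\<phi> x) - ?g x \<partial>\<mu>') \<le> (\<integral>x. ?q x - 1 \<partial>\<mu>')"
      using int int_g int_q by (intro integral_mono_AE) auto
    then have "(\<integral>x. ln (\<phi> x) \<partial>\<mu>') \<le> (\<integral>x. ?g x \<partial>\<mu>')"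
      using int int_g int_q q1 by (simp add: \<mu>'.prob_space)
    then show ?thesis
      by (simp add: relent_eq_integral[OF ac int_g])
  qed
qed

section \<open>The tranche loss and the vanishing of the payoff\<close>

lemma Lemp_mono:
  assumes "s \<le> t"
  shows "Lemp N \<tau> s \<omega> \<le> Lemp N \<tau> t \<omega>"
proof -
  have "indicator {..ennreal s} x \<le> (indicator {..ennreal t} x :: real)" for x
    using ennreal_leI[OF assms] by (auto simp: indicator_def intro: order_trans)
  then show ?thesis
    using assms by (auto simp: Lemp_def intro!: divide_right_mono divide_nonneg_nonneg sum_mono sum_nonneg)
qed

lemma Lbar_mono:
  assumes "\<alpha> < \<beta>" "s \<le> t"
  shows "Lbar N \<tau> \<alpha> \<beta> s \<omega> \<le> Lbar N \<tau> \<alpha> \<beta> t \<omega>"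
  unfolding Lbar_def
  using assms Lemp_mono[OF assms(2), of N \<tau> \<omega>] by (intro divide_right_mono) auto

text \<open>Only finitely many default times enter, so the function is constant immediately to the
  right of \<open>t\<close>. Negative \<open>t\<close> is separate because \<open>ennreal\<close>
  sends it to 0. With monotonicity this makes \<open>interval_measure\<close> the Stieltjes measure
  of the loss.\<close>

lemma continuous_at_right_Lemp:
  "continuous (at_right t) (\<lambda>s. Lemp N \<tau> s \<omega>)"
proof (cases "t < 0")
  case True
  have "eventually (\<lambda>s. s < 0) (at_right t)"
    using True by (auto simp: eventually_at_right)
  then have "eventually (\<lambda>s. Lemp N \<tau> s \<omega> = Lemp N \<tau> t \<omega>) (at_right t)"
    by eventually_elim (use True in \<open>simp add: Lemp_def\<close>)
  then show ?thesis
    by (simp add: continuous_within tendsto_eventually)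
next
  case False
  have ind: "eventually (\<lambda>s. indicator {..ennreal s} x = (indicator {..ennreal t} x :: real)) (at_right t)" for x
  proof (cases "x \<le> ennreal t")
    case True
    then show ?thesis
      by (intro eventually_mono[OF eventually_at_right_less[of t]])
         (auto simp: indicator_def intro: order_trans[OF _ ennreal_leI])
  next
    case x: False
    have "((\<lambda>s. ennreal s) \<longlongrightarrow> ennreal t) (at_right t)"
      by (intro tendsto_ennrealI tendsto_ident_at)
    then have "eventually (\<lambda>s. ennreal s < x) (at_right t)"
      using x by (intro order_tendstoD) auto
    then show ?thesis
      by eventually_elim (use x in \<open>auto simp: indicator_def\<close>)
  qed
  have "eventually (\<lambda>s. \<forall>n\<in>{1..N}. indicator {..ennreal s} (\<tau> n \<omega>)
      = (indicator {..ennreal t} (\<tau> n \<omega>) :: real)) (at_right t)"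
    using ind by (intro eventually_ball_finite) auto
  then have "eventually (\<lambda>s. Lemp N \<tau> s \<omega> = Lemp N \<tau> t \<omega>) (at_right t)"
    using eventually_at_right_less[of t]
    by eventually_elim (use False in \<open>simp add: Lemp_def\<close>)
  then show ?thesis
    by (simp add: continuous_within tendsto_eventually)
qed

lemma continuous_at_right_Lbar:
  "\<alpha> < \<beta> \<Longrightarrow> continuous (at_right t) (\<lambda>s. Lbar N \<tau> \<alpha> \<beta> s \<omega>)"
  unfolding Lbar_def
  using continuous_at_right_Lemp[of t N \<tau> \<omega>]
  by (auto intro!: tendsto_intros simp: continuous_within)

text \<open>The hypothesis on \<open>gammaN\<close> says that the fraction of defaults strictly
  before \<open>T\<close> is at most \<alpha>, and the loss at any \<open>t < T\<close> is bounded
  by that fraction. Both positive parts then vanish.\<close>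

lemma Lbar_eq_0:
  assumes "N \<ge> 1" "0 \<le> \<alpha>" "\<alpha> < \<beta>" "t < T" "gammaN N \<tau> T \<alpha> \<omega> \<le> 0"
  shows "Lbar N \<tau> \<alpha> \<beta> t \<omega> = 0"
proof -
  have "Lemp N \<tau> t \<omega> \<le> \<alpha>"
  proof (cases "t < 0")
    case False
    then have lt: "ennreal t < ennreal T"
      using assms by (simp add: ennreal_less_iff)
    have "(\<Sum>n\<in>{1..N}. indicator {..ennreal t} (\<tau> n \<omega>))
        \<le> (\<Sum>n\<in>{1..N}. indicator {..<ennreal T} (\<tau> n \<omega>) :: real)"
      using lt by (intro sum_mono) (auto simp: indicator_def intro: le_less_trans)
    also have "\<dots> \<le> \<alpha> * real N"
      using assms by (simp add: gammaN_def sum_subtractf mult.commute)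
    finally show ?thesis
      using assms False by (simp add: Lemp_def divide_le_eq)
  qed (use assms in \<open>simp add: Lemp_def\<close>)
  then show ?thesis
    using assms by (simp add: Lbar_def)
qed

lemma Pprot_eq_0:
  assumes "N \<ge> 1" "0 \<le> \<alpha>" "\<alpha> < \<beta>" "gammaN N \<tau> T \<alpha> \<omega> \<le> 0"
  shows "Pprot N \<tau> \<alpha> \<beta> R T \<omega> = 0"
proof -
  let ?L = "\<lambda>t. Lbar N \<tau> \<alpha> \<beta> t \<omega>"
  let ?M = "interval_measure ?L"
  \<comment> \<open>Starting at -1 makes the intervals include a possible atom at 0, and ending
    strictly below \<open>T\<close> leaves out the jump at \<open>T\<close>.\<close>
  let ?A = "\<lambda>k::nat. {-1 <.. T - 1 / Suc k}"
  have "?A k \<in> null_sets ?M" for k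
  proof (cases "-1 \<le> T - 1 / Suc k")
    case True
    have "emeasure ?M (?A k) = ennreal (?L (T - 1 / Suc k) - ?L (-1))"
      using True assms by (intro emeasure_interval_measure_Ioc Lbar_mono continuous_at_right_Lbar) auto
    also have "?L (T - 1 / Suc k) = 0"
      using assms by (intro Lbar_eq_0[where T=T]) auto
    also have "?L (-1) = 0"
      using assms by (simp add: Lbar_def Lemp_def)
    finally show ?thesis by (simp add: null_sets_def)
  qed (simp add: null_sets_def)
  then have "(\<Union>k. ?A k) \<in> null_sets ?M" by auto
  moreover have "{0..<T} \<subseteq> (\<Union>k. ?A k)"
  proof
    fix s assume "s \<in> {0..<T}"
    then have "0 < T - s" "0 \<le> s" by auto
    moreover obtain k where "1 / Suc k < T - s"
      using nat_approx_posE[OF \<open>0 < T - s\<close>] by auto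
    ultimately show "s \<in> (\<Union>k. ?A k)" by (auto intro!: exI[of _ k])
  qed
  ultimately have null: "{0..<T} \<in> null_sets ?M"
    using null_sets_subset[of "\<Union>k. ?A k" ?M "{0..<T}"] by auto
  have "AE s in ?M. indicator {0..<T} s * exp (- R * s) = (0::real)"
    using AE_not_in[OF null] by eventually_elim simp
  then show ?thesis
    unfolding Pprot_def by (rule integral_eq_zero_AE)
qed

section \<open>The tilted law and its entropy\<close>

text \<open>A real-valued version of the likelihood ratio fixed at every point, whereas
  \<open>RN_deriv\<close> is determined only almost everywhere.\<close>

definition tilt :: "ennreal measure \<Rightarrow> real \<Rightarrow> real \<Rightarrow> ennreal \<Rightarrow> real" where
  "tilt \<mu> T \<alpha> x = (if x < ennreal T then \<alpha> / measure \<mu> {..<ennreal T}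
     else (1 - \<alpha>) / (1 - measure \<mu> {..<ennreal T}))"

text \<open>The relative entropy of a Bernoulli law with parameter \<alpha> with respect to one with
  parameter \<open>\<mu>[0,T)\<close>.\<close>

definition tilt_entropy :: "ennreal measure \<Rightarrow> real \<Rightarrow> real \<Rightarrow> real" where
  "tilt_entropy \<mu> T \<alpha> = \<alpha> * ln (\<alpha> / measure \<mu> {..<ennreal T})
     + (1 - \<alpha>) * ln ((1 - \<alpha>) / (1 - measure \<mu> {..<ennreal T}))"

lemma mutilde_eq_density_tilt: "mutilde \<mu> T \<alpha> = density \<mu> (\<lambda>x. ennreal (tilt \<mu> T \<alpha> x))"
  by (simp add: mutilde_def tilt_def)

text \<open>The strict inequalities \<open>0 < F < \<alpha> < 1\<close> make both values of
  \<open>tilt\<close> positive, one above 1 before \<open>T\<close> and one below 1 after.\<close>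

locale tilted_law =
  fixes \<mu> :: "ennreal measure" and T \<alpha> :: real
  assumes prob_\<mu>: "prob_space \<mu>"
    and sets_\<mu>[measurable_cong]: "sets \<mu> = sets borel"
    and F_pos: "0 < measure \<mu> {..<ennreal T}"
    and F_less: "measure \<mu> {..<ennreal T} < \<alpha>"
    and \<alpha>_less_1: "\<alpha> < 1"
begin

sublocale \<mu>: prob_space \<mu> by (rule prob_\<mu>)

abbreviation "F \<equiv> measure \<mu> {..<ennreal T}"

lemma tilt_measurable[measurable]: "tilt \<mu> T \<alpha> \<in> borel_measurable borel"
  unfolding tilt_def by measurable

lemma tilt_pos: "0 < tilt \<mu> T \<alpha> x"
  using F_pos F_less \<alpha>_less_1 by (simp add: tilt_def)

text \<open>Both \<open>tilt\<close> and its logarithm are two-valued. The measure is arbitrary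
  because the formula serves \<mu>, the tilted law and every competitor in the infimum.\<close>

lemma integral_step:
  fixes a b :: real
  assumes \<nu>: "prob_space \<nu>" "sets \<nu> = sets (borel :: ennreal measure)"
  shows "integrable \<nu> (\<lambda>x. if x < ennreal T then a else b)"
    and "(\<integral>x. (if x < ennreal T then a else b) \<partial>\<nu>)
      = a * measure \<nu> {..<ennreal T} + b * (1 - measure \<nu> {..<ennreal T})"
proof -
  interpret \<nu>: prob_space \<nu> by fact
  note \<nu>(2)[measurable_cong]
  have eq: "(\<lambda>x. if x < ennreal T then a else b) = (\<lambda>x. (a - b) * indicator {..<ennreal T} x + b)"
    by (auto simp: indicator_def)
  have ind: "integrable \<nu> (indicator {..<ennreal T} :: _ \<Rightarrow> real)"
    by (rule \<nu>.integrable_const_bound[where B=1]) auto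
  show "integrable \<nu> (\<lambda>x. if x < ennreal T then a else b)"
    unfolding eq using ind by auto
  have "space \<nu> = UNIV"
    using sets_eq_imp_space_eq[OF \<nu>(2)] by simp
  then show "(\<integral>x. (if x < ennreal T then a else b) \<partial>\<nu>)
      = a * measure \<nu> {..<ennreal T} + b * (1 - measure \<nu> {..<ennreal T})"
    unfolding eq using ind \<nu>.prob_space by (simp add: algebra_simps)
qed

lemma nn_integral_tilt: "(\<integral>\<^sup>+x. ennreal (tilt \<mu> T \<alpha> x) \<partial>\<mu>) = 1"
proof -
  have "integrable \<mu> (tilt \<mu> T \<alpha>)"
    unfolding tilt_def by (rule integral_step[OF prob_\<mu> sets_\<mu>])
  then have "(\<integral>\<^sup>+x. ennreal (tilt \<mu> T \<alpha> x) \<partial>\<mu>) = ennreal (\<integral>x. tilt \<mu> T \<alpha> x \<partial>\<mu>)"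
    using tilt_pos by (intro nn_integral_eq_integral) (auto intro: less_imp_le)
  also have "(\<integral>x. tilt \<mu> T \<alpha> x \<partial>\<mu>) = 1"
    unfolding tilt_def integral_step(2)[OF prob_\<mu> sets_\<mu>]
    using F_pos F_less \<alpha>_less_1 by simp
  finally show ?thesis by simp
qed

lemma sets_mutilde[simp]: "sets (mutilde \<mu> T \<alpha>) = sets borel"
  by (simp add: mutilde_def sets_\<mu>)

lemma prob_space_mutilde: "prob_space (mutilde \<mu> T \<alpha>)"
proof
  show "emeasure (mutilde \<mu> T \<alpha>) (space (mutilde \<mu> T \<alpha>)) = 1"
    using nn_integral_tilt
    by (simp add: mutilde_eq_density_tilt emeasure_density cong: nn_integral_cong)
qed

lemma measure_mutilde: "measure (mutilde \<mu> T \<alpha>) {..<ennreal T} = \<alpha>"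
proof -
  have "emeasure (mutilde \<mu> T \<alpha>) {..<ennreal T}
      = (\<integral>\<^sup>+x. ennreal (\<alpha> / F) * indicator {..<ennreal T} x \<partial>\<mu>)"
    unfolding mutilde_eq_density_tilt
    by (subst emeasure_density) (auto simp: tilt_def indicator_def intro!: nn_integral_cong)
  also have "\<dots> = ennreal (\<alpha> / F) * emeasure \<mu> {..<ennreal T}"
    by (intro nn_integral_cmult_indicator) (simp add: sets_\<mu>)
  also have "\<dots> = ennreal \<alpha>"
    using F_pos F_less by (simp add: \<mu>.emeasure_eq_measure flip: ennreal_mult)
  finally show ?thesis
    using F_pos F_less by (simp add: measure_def)
qed

lemma RN_deriv_mutilde: "AE x in \<mu>. RN_deriv \<mu> (mutilde \<mu> T \<alpha>) x = ennreal (tilt \<mu> T \<alpha> x)"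
  using \<mu>.RN_deriv_unique[of "\<lambda>x. ennreal (tilt \<mu> T \<alpha> x)" "mutilde \<mu> T \<alpha>"]
  by (auto simp: mutilde_eq_density_tilt elim: eventually_mono)

lemma absolutely_continuous_mutilde: "absolutely_continuous \<mu> (mutilde \<mu> T \<alpha>)"
  unfolding mutilde_eq_density_tilt by (intro absolutely_continuousI_density) measurable

lemma ln_tilt: "ln (tilt \<mu> T \<alpha> x) = (if x < ennreal T then ln (\<alpha> / F) else ln ((1 - \<alpha>) / (1 - F)))"
  by (simp add: tilt_def)

text \<open>The log density takes two values, and the tilted law gives \<open>[0,T)\<close> mass
  exactly \<alpha>, so its mean is the weighted sum in \<open>tilt_entropy\<close>.\<close>

lemma relent_mutilde: "relent (mutilde \<mu> T \<alpha>) \<mu> = ereal (tilt_entropy \<mu> T \<alpha>)"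
proof -
  let ?m = "mutilde \<mu> T \<alpha>"
  let ?g = "\<lambda>x. ln (enn2real (RN_deriv \<mu> ?m x))"
  have [measurable_cong]: "sets ?m = sets \<mu>" by (simp add: sets_\<mu>)
  have "AE x in \<mu>. ?g x = ln (tilt \<mu> T \<alpha> x)"
    using RN_deriv_mutilde by eventually_elim (simp add: less_imp_le[OF tilt_pos])
  then have ae: "AE x in ?m. ?g x = ln (tilt \<mu> T \<alpha> x)"
    unfolding mutilde_eq_density_tilt by (subst AE_density) auto
  note step = integral_step[OF prob_space_mutilde sets_mutilde, of "ln (\<alpha> / F)" "ln ((1 - \<alpha>) / (1 - F))"]
  have int: "integrable ?m (\<lambda>x. ln (tilt \<mu> T \<alpha> x))"
    unfolding ln_tilt by (rule step)
  have "integrable ?m ?g"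
    using int ae by (subst integrable_cong_AE[where g="\<lambda>x. ln (tilt \<mu> T \<alpha> x)"]) auto
  then have "relent ?m \<mu> = ereal (\<integral>x. ?g x \<partial>?m)"
    by (rule relent_eq_integral[OF absolutely_continuous_mutilde])
  also have "(\<integral>x. ?g x \<partial>?m) = (\<integral>x. ln (tilt \<mu> T \<alpha> x) \<partial>?m)"
    using ae by (intro integral_cong_AE) auto
  also have "\<dots> = tilt_entropy \<mu> T \<alpha>"
    unfolding ln_tilt step(2) by (simp add: tilt_entropy_def measure_mutilde mult.commute)
  finally show ?thesis .
qed

lemma Ifrak_eq: "Ifrak \<mu> T \<alpha> = ereal (tilt_entropy \<mu> T \<alpha>)"
  unfolding Ifrak_def
proof (intro antisym Inf_greatest)
  show "Inf {relent \<mu>' \<mu> | \<mu>'. prob_space \<mu>' \<and> sets \<mu>' = sets (borel :: ennreal measure)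
      \<and> \<alpha> \<le> measure \<mu>' {..<ennreal T}} \<le> ereal (tilt_entropy \<mu> T \<alpha>)"
    using relent_mutilde prob_space_mutilde measure_mutilde
    by (intro Inf_lower CollectI exI[of _ "mutilde \<mu> T \<alpha>"]) auto
next
  fix e assume "e \<in> {relent \<mu>' \<mu> | \<mu>'. prob_space \<mu>' \<and> sets \<mu>' = sets (borel :: ennreal measure)
      \<and> \<alpha> \<le> measure \<mu>' {..<ennreal T}}"
  then obtain \<mu>' where e: "e = relent \<mu>' \<mu>" and \<mu>': "prob_space \<mu>'" "sets \<mu>' = sets borel"
    and ge: "\<alpha> \<le> measure \<mu>' {..<ennreal T}" by auto
  let ?p = "measure \<mu>' {..<ennreal T}" and ?a = "ln (\<alpha> / F)" and ?b = "ln ((1 - \<alpha>) / (1 - F))"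
  note step = integral_step[OF \<mu>', of ?a ?b]
  have "?b \<le> ?a"
    using F_pos F_less \<alpha>_less_1 by (subst ln_le_cancel_iff) (auto simp: field_simps)
  \<comment> \<open>The mean of \<open>ln tilt\<close> under \<mu>' is affine in \<open>?p\<close>
    with slope \<open>?a - ?b\<close>. This product is exactly its excess over the value at
    \<alpha>, which is \<open>tilt_entropy\<close>.\<close>
  then have "0 \<le> (?p - \<alpha>) * (?a - ?b)"
    using ge by (intro mult_nonneg_nonneg) auto
  then have "tilt_entropy \<mu> T \<alpha> \<le> ?a * ?p + ?b * (1 - ?p)"
    by (simp add: tilt_entropy_def algebra_simps)
  also have "\<dots> = (\<integral>x. ln (tilt \<mu> T \<alpha> x) \<partial>\<mu>')"
    unfolding ln_tilt step(2) ..
  finally have "ereal (tilt_entropy \<mu> T \<alpha>) \<le> ereal (\<integral>x. ln (tilt \<mu> T \<alpha> x) \<partial>\<mu>')"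
    by simp
  also have "\<dots> \<le> relent \<mu>' \<mu>"
  proof (rule relent_ge_integral_ln[OF prob_\<mu> \<mu>'(1)])
    show "integrable \<mu>' (\<lambda>x. ln (tilt \<mu> T \<alpha> x))"
      unfolding ln_tilt by (rule step)
  qed (auto simp: \<mu>' sets_\<mu> tilt_pos nn_integral_tilt)
  finally show "ereal (tilt_entropy \<mu> T \<alpha>) \<le> e"
    by (simp add: e)
qed

text \<open>\<open>kappa\<close> is the gap between the two values of \<open>ln tilt\<close> and
  \<open>tilt_entropy\<close> is their average with weights \<alpha> and
  \<open>1 - \<alpha>\<close>. Hence \<open>ln tilt\<close> is that average plus
  \<open>kappa\<close> times the centred indicator, and summing over \<open>n\<close> produces
  \<open>gammaN\<close>.\<close>

lemma prod_tilt:
  "(\<Prod>n\<in>{1..N}. tilt \<mu> T \<alpha> (\<tau> n \<omega>))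
    = exp (real N * tilt_entropy \<mu> T \<alpha> + kappa \<mu> T \<alpha> * gammaN N \<tau> T \<alpha> \<omega>)"
proof -
  let ?a = "ln (\<alpha> / F)" and ?b = "ln ((1 - \<alpha>) / (1 - F))"
  have kappa: "kappa \<mu> T \<alpha> = ?a - ?b"
    unfolding kappa_def using F_pos F_less \<alpha>_less_1
    by (subst ln_mult) (auto simp: ln_div)
  have "tilt \<mu> T \<alpha> (\<tau> n \<omega>)
      = exp (tilt_entropy \<mu> T \<alpha> + kappa \<mu> T \<alpha> * (indicator {..<ennreal T} (\<tau> n \<omega>) - \<alpha>))" for n
  proof -
    have "tilt_entropy \<mu> T \<alpha> + kappa \<mu> T \<alpha> * (indicator {..<ennreal T} (\<tau> n \<omega>) - \<alpha>)
        = ln (tilt \<mu> T \<alpha> (\<tau> n \<omega>))"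
      unfolding ln_tilt kappa by (simp add: tilt_entropy_def indicator_def algebra_simps)
    then show ?thesis by (simp add: tilt_pos)
  qed
  then have "(\<Prod>n\<in>{1..N}. tilt \<mu> T \<alpha> (\<tau> n \<omega>)) = exp (\<Sum>n\<in>{1..N}. tilt_entropy \<mu> T \<alpha>
      + kappa \<mu> T \<alpha> * (indicator {..<ennreal T} (\<tau> n \<omega>) - \<alpha>))"
    by (simp only: exp_sum finite_atLeastAtMost)
  also have "\<dots> = exp (real N * tilt_entropy \<mu> T \<alpha> + kappa \<mu> T \<alpha> * gammaN N \<tau> T \<alpha> \<omega>)"
    unfolding gammaN_def sum.distrib sum_distrib_left by simp
  finally show ?thesis .
qed

text \<open>Each \<open>\<tau> n\<close> has law \<mu>, so the \<mu>-a.e. identity between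
  \<open>RN_deriv\<close> and \<open>tilt\<close> pulls back to a P-a.e. one, and finitely many
  factors share one null set.\<close>

lemma Ptilde_eq:
  assumes [measurable]: "\<And>n. \<tau> n \<in> borel_measurable P"
    and law: "\<And>n. distr P borel (\<tau> n) = \<mu>"
  shows "Ptilde P \<mu> \<tau> T \<alpha> N = density P (\<lambda>\<omega>. ennreal (exp (real N * tilt_entropy \<mu> T \<alpha>
      + kappa \<mu> T \<alpha> * gammaN N \<tau> T \<alpha> \<omega>)))"
  unfolding Ptilde_def
proof (rule density_cong)
  have "AE \<omega> in P. RN_deriv \<mu> (mutilde \<mu> T \<alpha>) (\<tau> n \<omega>) = ennreal (tilt \<mu> T \<alpha> (\<tau> n \<omega>))" for n
    by (rule AE_distrD[where M'=borel]) (simp_all only: law RN_deriv_mutilde assms(1))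
  then have "AE \<omega> in P. \<forall>n\<in>{1..N}. RN_deriv \<mu> (mutilde \<mu> T \<alpha>) (\<tau> n \<omega>) = ennreal (tilt \<mu> T \<alpha> (\<tau> n \<omega>))"
    by (intro AE_finite_allI) auto
  then show "AE \<omega> in P. (\<Prod>n\<in>{1..N}. RN_deriv \<mu> (mutilde \<mu> T \<alpha>) (\<tau> n \<omega>))
      = ennreal (exp (real N * tilt_entropy \<mu> T \<alpha> + kappa \<mu> T \<alpha> * gammaN N \<tau> T \<alpha> \<omega>))"
  proof eventually_elim
    case (elim \<omega>)
    then show ?case
      unfolding prod_tilt[symmetric] by (simp add: prod_ennreal less_imp_le[OF tilt_pos])
  qed
next
  have "\<tau> n \<in> measurable P \<mu>" for n
    using assms(1)[of n] by (simp cong: measurable_cong_sets add: sets_\<mu>)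
  then show "(\<lambda>\<omega>. \<Prod>n\<in>{1..N}. RN_deriv \<mu> (mutilde \<mu> T \<alpha>) (\<tau> n \<omega>)) \<in> borel_measurable P"
    by (intro borel_measurable_prod_ennreal measurable_compose[OF _ borel_measurable_RN_deriv])
next
  show "(\<lambda>\<omega>. ennreal (exp (real N * tilt_entropy \<mu> T \<alpha> + kappa \<mu> T \<alpha> * gammaN N \<tau> T \<alpha> \<omega>)))
      \<in> borel_measurable P"
    unfolding gammaN_def by measurable
qed

end

section \<open>The representation under the tilted measure\<close>

theorem theorem4p1:
  fixes P :: "'a measure" and \<mu> :: "ennreal measure" and \<tau> :: "nat \<Rightarrow> 'a \<Rightarrow> ennreal"
    and T R \<alpha> \<beta> :: real and N :: nat
  assumes P: "prob_space P"
    and mu: "prob_space \<mu>" "sets \<mu> = sets (borel :: ennreal measure)"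
    and indep: "prob_space.indep_vars P (\<lambda>_. borel) \<tau> UNIV"
    and law: "\<And>n. distr P borel (\<tau> n) = \<mu>"
    and T: "T > 0" and R: "R \<ge> 0"
    and ab: "0 \<le> \<alpha>" "\<alpha> < \<beta>" "\<beta> \<le> 1"
    and F: "\<alpha> > measure \<mu> {..<ennreal T}" "measure \<mu> {..<ennreal T} > 0"
    and incr: "\<And>T'. 0 \<le> T' \<Longrightarrow> T' < T \<Longrightarrow> measure \<mu> {..<ennreal T'} < measure \<mu> {..ennreal T}"
    and N: "N \<ge> 1"
  shows "Ifrak \<mu> T \<alpha> \<noteq> \<infinity> \<and> Ifrak \<mu> T \<alpha> \<noteq> -\<infinity>
    \<and> (\<integral>\<omega>. Pprot N \<tau> \<alpha> \<beta> R T \<omega> \<partial>P) =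
        (\<integral>\<omega>. Pprot N \<tau> \<alpha> \<beta> R T \<omega> * exp (- kappa \<mu> T \<alpha> * gammaN N \<tau> T \<alpha> \<omega>)
               * indicator {\<omega>. gammaN N \<tau> T \<alpha> \<omega> > 0} \<omega> \<partial>Ptilde P \<mu> \<tau> T \<alpha> N)
        * exp (- real N * real_of_ereal (Ifrak \<mu> T \<alpha>))
    \<and> prob_space (Ptilde P \<mu> \<tau> T \<alpha> N)
    \<and> prob_space.indep_vars (Ptilde P \<mu> \<tau> T \<alpha> N) (\<lambda>_. borel) \<tau> {1..N}
    \<and> (\<forall>n\<in>{1..N}. distr (Ptilde P \<mu> \<tau> T \<alpha> N) borel (\<tau> n) = mutilde \<mu> T \<alpha>)"
proof -
  interpret P: prob_space P by fact
  interpret tilted_law \<mu> T \<alpha>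
    by (rule tilted_law.intro) (use mu F ab in linarith | fact)+
  have \<tau>[measurable]: "\<And>n. \<tau> n \<in> borel_measurable P"
    using indep unfolding P.indep_vars_def by blast
  let ?P = "Pprot N \<tau> \<alpha> \<beta> R T" and ?\<kappa> = "kappa \<mu> T \<alpha>" and ?\<gamma> = "gammaN N \<tau> T \<alpha>"
  let ?J = "tilt_entropy \<mu> T \<alpha>"
  let ?Q = "Ptilde P \<mu> \<tau> T \<alpha> N"
  let ?d = "\<lambda>\<omega>. exp (real N * ?J + ?\<kappa> * ?\<gamma> \<omega>)"
  have \<gamma>[measurable]: "?\<gamma> \<in> borel_measurable P"
    unfolding gammaN_def by measurable
  have Q: "?Q = density P (\<lambda>\<omega>. ennreal (?d \<omega>))"
    by (rule Ptilde_eq[OF \<tau> law])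
  have drop_ind: "?P \<omega> * exp (- ?\<kappa> * ?\<gamma> \<omega>) * indicator {\<omega>. ?\<gamma> \<omega> > 0} \<omega> = ?P \<omega> * exp (- ?\<kappa> * ?\<gamma> \<omega>)" for \<omega>
    using Pprot_eq_0[OF N ab(1,2), of \<tau> T \<omega> R] by (cases "?\<gamma> \<omega> > 0") auto
  have identity: "(\<integral>\<omega>. ?P \<omega> \<partial>P) = (\<integral>\<omega>. ?P \<omega> * exp (- ?\<kappa> * ?\<gamma> \<omega>) \<partial>?Q) * exp (- real N * ?J)"
  proof (cases "?P \<in> borel_measurable P") \<comment> \<open>otherwise neither side is integrable and both vanish\<close>
    case True
    have "(\<integral>\<omega>. ?P \<omega> * exp (- ?\<kappa> * ?\<gamma> \<omega>) \<partial>?Q)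
        = (\<integral>\<omega>. ?d \<omega> *\<^sub>R (?P \<omega> * exp (- ?\<kappa> * ?\<gamma> \<omega>)) \<partial>P)"
      unfolding Q using True by (intro integral_density) auto
    \<comment> \<open>The factor \<open>exp (- ?\<kappa> * ?\<gamma> \<omega>)\<close> cancels the
      random part of the likelihood ratio and leaves the constant
      \<open>exp (real N * ?J)\<close>.\<close>
    also have "\<dots> = (\<integral>\<omega>. exp (real N * ?J) * ?P \<omega> \<partial>P)"
      by (intro Bochner_Integration.integral_cong) (simp_all add: exp_add exp_minus)
    finally show ?thesis by (simp add: exp_minus)
  next
    case False
    have "\<not> integrable ?Q (\<lambda>\<omega>. ?P \<omega> * exp (- ?\<kappa> * ?\<gamma> \<omega>))"
    proof
      assume "integrable ?Q (\<lambda>\<omega>. ?P \<omega> * exp (- ?\<kappa> * ?\<gamma> \<omega>))"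
      then have [measurable]: "(\<lambda>\<omega>. ?P \<omega> * exp (- ?\<kappa> * ?\<gamma> \<omega>)) \<in> borel_measurable P"
        by (auto simp: Q dest: borel_measurable_integrable)
      \<comment> \<open>Multiplying by the reciprocal exponential recovers \<open>?P\<close>, which
        would then be measurable.\<close>
      have "(\<lambda>\<omega>. (?P \<omega> * exp (- ?\<kappa> * ?\<gamma> \<omega>)) * exp (?\<kappa> * ?\<gamma> \<omega>)) \<in> borel_measurable P"
        by measurable
      then show False using False by (simp add: mult.assoc flip: exp_add)
    qed
    moreover have "\<not> integrable P ?P"
      using False by (auto dest: borel_measurable_integrable)
    ultimately show ?thesis
      by (simp add: not_integrable_integral_eq)
  qed
  let ?\<phi> = "RN_deriv \<mu> (mutilde \<mu> T \<alpha>)"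
  have dens: "density \<mu> ?\<phi> = mutilde \<mu> T \<alpha>"
    by (rule \<mu>.density_RN_deriv[OF absolutely_continuous_mutilde]) (simp add: sets_\<mu>)
  have indep': "P.indep_vars (\<lambda>_. borel) \<tau> {1..N}"
    using indep by (rule P.indep_vars_subset) auto
  \<comment> \<open>Choosing \<open>RN_deriv\<close> itself as the density makes the weighted
    measure literally \<open>Ptilde\<close>, and \<open>dens\<close> identifies the new
    marginal.\<close>
  note tilted = indep_vars_product_density[OF P _ _ indep' law, of ?\<phi>, folded Ptilde_def, unfolded dens]
  have "{1..N} \<noteq> {}" using N by auto
  then have "prob_space ?Q" "prob_space.indep_vars ?Q (\<lambda>_. borel) \<tau> {1..N}"
      "\<forall>n\<in>{1..N}. distr ?Q borel (\<tau> n) = mutilde \<mu> T \<alpha>"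
    using tilted prob_space_mutilde by auto
  then show ?thesis
    unfolding Ifrak_eq drop_ind using identity by simp
qed

end
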